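(* Let $m,l,\delta\in\mathbb{N}$ and let $T$ be a tree with $T\in\mathcal{T}_{m,l+1}^{\delta}$. Let $n\ge m$ and let $H=H_1\vee H_2$, where $H_1$ is a graph on $l$ vertices and $H_2$ is a graph on $n-l$ vertices. (i) If $\Delta(H_2)\ge\delta$, then $T$ can be embedded in $H$. (ii) If $\Delta(H_2)\le\delta-1$ and at most one vertex of $H_2$ has degree $\delta-1$, then $T$ cannot be embedded in $H$.
   Context: Every tree $T$ has a unique bipartition $\{A,B\}$ with $|A|\le|B|$. $\mathcal{T}_{m,l+1}^{\delta}$ denotes the set of trees on $m$ vertices whose smaller partite set $A$ has exactly $l+1$ vertices and such that $\min\{d_T(v):v\in A\}=\delta$ (when $|A|=|B|$ this minimum equals $1$ for either choice of $A$). For vertex-disjoint graphs $G_1,G_2$, the join $G_1\vee G_2$ is the graph on $V(G_1)\cup V(G_2)$ with edge set $E(G_1)\cup E(G_2)\cup\{uv:u\in V(G_1),v\in V(G_2)\}$. "$T$ can be embedded in $H$" means $H$ contains a subgraph isomorphic to $T$. $\Delta(\cdot)$ denotes maximum degree. *)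

theory Defs
  imports "Graph_Theory.Graph_Theory"
begin

text \<open>
  A finite simple graph is a \<^locale>\<open>pair_graph\<close>: a finite, loop-free, symmetric digraph
  without parallel arcs, each undirected edge being represented by its two orientations.
  Hence the degree of a vertex is its out-degree.
\<close>

abbreviation vdegree :: "'a pair_pre_digraph \<Rightarrow> 'a \<Rightarrow> nat" where
  "vdegree G v \<equiv> out_degree (with_proj G) v"

definition max_degree :: "'a pair_pre_digraph \<Rightarrow> nat" where
  "max_degree G = Max (vdegree G ` pverts G)"

text \<open>
  The library constant \<^const>\<open>tree\<close> does not describe undirected trees: in a symmetric
  digraph each edge gives a directed cycle of length 2. The cycles of the
  undirected graph are the directed cycles of length at least 3.
\<close>

definition undirected_tree :: "'a pair_pre_digraph \<Rightarrow> bool" where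
  "undirected_tree T \<longleftrightarrow> pair_graph T \<and> connected (with_proj T) \<and>
     \<not> (\<exists>p. pre_digraph.cycle (with_proj T) p \<and> 3 \<le> length p)"

definition bipartition :: "'a pair_pre_digraph \<Rightarrow> 'a set \<Rightarrow> 'a set \<Rightarrow> bool" where
  "bipartition G A B \<longleftrightarrow> A \<union> B = pverts G \<and> A \<inter> B = {} \<and> parcs G \<subseteq> A \<times> B \<union> B \<times> A"

text \<open>
  The bipartition of a tree is unique up to exchanging the two parts, so the existential
  quantifier leaves a choice only if both parts have the same size. In that case each of
  them contains a leaf and the minimum is 1 for either choice.
\<close>

definition tree_class :: "nat \<Rightarrow> nat \<Rightarrow> nat \<Rightarrow> 'a pair_pre_digraph set" where
  "tree_class m k \<delta> = {T. undirected_tree T \<and> card (pverts T) = m \<and>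
     (\<exists>A B. bipartition T A B \<and> card A \<le> card B \<and> card A = k \<and> Min (vdegree T ` A) = \<delta>)}"

text \<open>Only meaningful for graphs with disjoint vertex sets.\<close>

definition graph_join :: "'a pair_pre_digraph \<Rightarrow> 'a pair_pre_digraph \<Rightarrow> 'a pair_pre_digraph" where
  "graph_join G1 G2 = \<lparr> pverts = pverts G1 \<union> pverts G2,
     parcs = parcs G1 \<union> parcs G2 \<union> pverts G1 \<times> pverts G2 \<union> pverts G2 \<times> pverts G1 \<rparr>"

definition embeds_in :: "'a pair_pre_digraph \<Rightarrow> 'b pair_pre_digraph \<Rightarrow> bool" where
  "embeds_in T H \<longleftrightarrow> (\<exists>S. pair_graph S \<and> subgraph (with_proj S) (with_proj H) \<and>
     digraph_iso (with_proj T) (with_proj S))"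

end

theory Submission
  imports Defs
begin

text \<open>
  (i) Put a vertex of \<open>A\<close> of degree \<open>\<delta>\<close> on a vertex of maximum degree of \<open>H\<^sub>2\<close>, its neighbours on
  neighbours of the latter, the other \<open>l\<close> vertices of \<open>A\<close> on \<open>H\<^sub>1\<close>, and the rest of \<open>B\<close> anywhere
  in \<open>H\<^sub>2\<close>.

  (ii) Given an embedding, let \<open>A'\<close> be the vertices of \<open>A\<close> not mapped to \<open>H\<^sub>1\<close> and \<open>X\<close> the vertices
  of \<open>B\<close> mapped to \<open>H\<^sub>1\<close>. As \<open>H\<^sub>1\<close> has fewer vertices than \<open>A\<close>, we have \<open>|X| < |A'|\<close>. By the
  degree bounds in \<open>H\<^sub>2\<close>, each vertex of \<open>A'\<close> has at least two neighbours in \<open>X\<close>, with at most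
  one exception, which still has one. So there are at least \<open>2|A'| - 1 \<ge> |A'| + |X|\<close> edges between
  \<open>A'\<close> and \<open>X\<close>, too many for a forest.
\<close>

section \<open>Degrees, cycles and edge counts in forests\<close>

lemma vdegree_eq_card_Image: "vdegree G v = card (parcs G `` {v})"
proof -
  have "out_arcs (with_proj G) v = Pair v ` (parcs G `` {v})"
    by (auto simp: out_arcs_def)
  then show ?thesis
    by (simp add: out_degree_def card_image inj_on_def)
qed

text \<open>Of two neighbours in \<open>W\<close> of the start of a longest path, one is not the
  next vertex; the edge to it closes a cycle. Contraposition gives each nonempty vertex subset of a
  forest a vertex with at most one neighbour in it.\<close>

lemma (in pair_graph) ex_cycle_if_min_degree_ge_2:
  assumes W: "W \<subseteq> pverts G" "W \<noteq> {}"
    and deg: "\<And>v. v \<in> W \<Longrightarrow> 2 \<le> card (parcs G `` {v} \<inter> W)"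
  shows "\<exists>p. cycle p \<and> 3 \<le> length p"
proof -
  \<comment> \<open>All neighbours in \<open>W\<close> of the first vertex of a longest path inside \<open>W\<close> lie on that path.\<close>
  define P where "P p \<longleftrightarrow> (\<exists>u v. apath u p v \<and> set (awalk_verts u p) \<subseteq> W)" for p
  from W obtain w where "w \<in> W" by blast
  with W have "P []"
    unfolding P_def by (intro exI[of _ w]) (auto simp: apath_Nil_iff)
  moreover have "length p < Suc (card W)" if "P p" for p
  proof -
    from that obtain u v where "apath u p v" "set (awalk_verts u p) \<subseteq> W"
      unfolding P_def by blast
    then have "length (awalk_verts u p) \<le> card W"
      using W finite_subset pair_finite_verts
      by (metis apath_def card_mono distinct_card)
    then show ?thesis by (simp add: length_awalk_verts)
  qed
  ultimately obtain p where "P p" and max: "\<And>q. P q \<Longrightarrow> length q \<le> length p"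
    using ex_has_greatest_nat[of P "[]" length "Suc (card W)"] by blast
  then obtain u v where p: "apath u p v" "set (awalk_verts u p) \<subseteq> W"
    unfolding P_def by blast
  have "u \<in> W" using p hd_in_awalk_verts by blast
  \<comment> \<open>\<open>x\<close> is the second vertex of the path. Avoiding it keeps the closing
    edge from merely retracing the first arc. For the empty path \<open>u\<close> is only a default
    value.\<close>
  define x where "x = (if p = [] then u else snd (hd p))"
  have "\<not> parcs G `` {u} \<inter> W \<subseteq> {x}"
    using deg[OF \<open>u \<in> W\<close>] card_mono[of "{x}" "parcs G `` {u} \<inter> W"] by auto
  then obtain y where y: "(u, y) \<in> parcs G" "y \<in> W" "y \<noteq> x" by blast
  then have yu: "(y, u) \<in> parcs G" "y \<noteq> u"
    using arcs_symmetric no_loops' by auto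
  have "y \<in> set (awalk_verts u p)"
  proof (rule ccontr)
    assume "y \<notin> set (awalk_verts u p)"
    then have "apath y ((y, u) # p) v"
      using p yu by (simp add: apath_Cons_iff)
    then have "P ((y, u) # p)"
      unfolding P_def using p y by (intro exI[of _ y] exI[of _ v]) simp
    from max[OF this] show False by simp
  qed
  then obtain q r where qr: "p = q @ r" "awalk u q y" "awalk y r v"
    using p awalk_decomp[of u p v y] by (auto simp: apath_def)
  have "awalk y ((y, u) # q) y"
    using qr yu by (simp add: awalk_Cons_iff)
  moreover have "distinct (awalk_verts u q)"
    using p(1) unfolding qr(1) apath_append_iff by (simp add: apath_def)
  ultimately have "cycle ((y, u) # q)"
    unfolding cycle_def by (intro exI[of _ y]) simp
  \<comment> \<open>\<open>q\<close> is not empty because \<open>y \<noteq> u\<close>, and it is not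
    a single arc because \<open>y \<noteq> x\<close>.\<close>
  moreover have "2 \<le> length q"
  proof (cases q)
    case Nil
    then show ?thesis using qr yu by (simp add: awalk_Nil_iff)
  next
    case (Cons e es)
    then show ?thesis using qr y
      by (cases es) (auto simp: x_def awalk_simps)
  qed
  ultimately show ?thesis by (intro exI[of _ "(y, u) # q"]) simp
qed

text \<open>An edge is a pair of arcs, so this is the bound \<open>|W| - 1\<close> for the edges of a forest.\<close>

lemma (in pair_graph) card_arcs_acyclic:
  assumes acyc: "\<not> (\<exists>p. cycle p \<and> 3 \<le> length p)"
    and "W \<subseteq> pverts G" "W \<noteq> {}"
  shows "card (parcs G \<inter> W \<times> W) + 2 \<le> 2 * card W"
proof -
  have "finite W" using assms pair_finite_verts finite_subset by blast
  then show ?thesis using assms(2,3)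
  proof (induction W rule: finite_remove_induct)
    case empty
    then show ?case by simp
  next
    case (remove W)
    \<comment> \<open>Deleting \<open>w\<close> loses at most one edge, that is two arcs, while the
      bound \<open>2 * card W\<close> drops by two.\<close>
    then obtain w where w: "w \<in> W" "card (parcs G `` {w} \<inter> W) \<le> 1"
      using ex_cycle_if_min_degree_ge_2[of W] acyc by force
    let ?N = "parcs G `` {w} \<inter> W" and ?E = "\<lambda>W. parcs G \<inter> W \<times> W"
    have sub: "?E W \<subseteq> ?E (W - {w}) \<union> ({w} \<times> ?N \<union> ?N \<times> {w})"
      using arcs_symmetric by auto
    have fin: "finite ?N" "finite (?E (W - {w}))"
      using remove by auto
    have "card ({w} \<times> ?N \<union> ?N \<times> {w}) \<le> card ?N + card ?N"
      using card_Un_le[of "{w} \<times> ?N" "?N \<times> {w}"] by (simp add: card_cartesian_product)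
    with w have "card ({w} \<times> ?N \<union> ?N \<times> {w}) \<le> 2" by simp
    moreover have "card (?E W) \<le> card (?E (W - {w}) \<union> ({w} \<times> ?N \<union> ?N \<times> {w}))"
      using sub fin by (intro card_mono) auto
    moreover have "\<dots> \<le> card (?E (W - {w})) + card ({w} \<times> ?N \<union> ?N \<times> {w})"
      by (rule card_Un_le)
    ultimately have le: "card (?E W) \<le> card (?E (W - {w})) + 2" by linarith
    have cW: "card W = Suc (card (W - {w}))"
      using w remove by (metis card_Suc_Diff1)
    \<comment> \<open>Singletons are the real base case, since the bound fails for the empty
      set.\<close>
    show ?case
    proof (cases "W = {w}")
      case True
      then have "?E W = {}" using no_loops' by auto
      then show ?thesis using True by simp
    next
      case False
      then have "card (?E (W - {w})) + 2 \<le> 2 * card (W - {w})"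
        using remove.IH[of w] remove w by blast
      then show ?thesis using le cW by simp
    qed
  qed
qed

section \<open>Joins, and embeddings as injective vertex maps\<close>

lemma pair_graph_graph_join:
  assumes "pair_graph G1" "pair_graph G2" "pverts G1 \<inter> pverts G2 = {}"
  shows "pair_graph (graph_join G1 G2)"
proof -
  interpret G1: pair_graph G1 by fact
  interpret G2: pair_graph G2 by fact
  have "sym (parcs G1)" "sym (parcs G2)"
    using G1.arcs_symmetric G2.arcs_symmetric by (auto intro: symI)
  then have "sym (parcs (graph_join G1 G2))"
    unfolding graph_join_def sym_def by auto
  then have "symmetric (with_proj (graph_join G1 G2))"
    by (simp add: symmetric_def)
  then show ?thesis
    using assms(3) G1.pair_finite_verts G2.pair_finite_verts
      G1.pair_finite_arcs G2.pair_finite_arcs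
    by unfold_locales
      (auto simp: graph_join_def dest: G1.wellformed' G2.wellformed' G1.no_loops' G2.no_loops')
qed

text \<open>Without parallel arcs, an isomorphism is determined by its action on vertices. This lets
  both halves of the theorem work with vertex maps alone.\<close>

lemma embeds_in_iff:
  assumes "pair_graph T" "pair_graph H"
  shows "embeds_in T H \<longleftrightarrow> (\<exists>f. inj_on f (pverts T) \<and> f ` pverts T \<subseteq> pverts H \<and>
    (\<forall>u v. (u, v) \<in> parcs T \<longrightarrow> (f u, f v) \<in> parcs H))" (is "_ \<longleftrightarrow> ?R")
proof
  interpret T: pair_graph T by fact
  interpret H: pair_graph H by fact
  {
    assume "embeds_in T H"
    then obtain S h where S: "pair_graph S" "subgraph (with_proj S) (with_proj H)"
      and h: "T.digraph_isomorphism h" "with_proj S = app_iso h (with_proj T)"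
      unfolding embeds_in_def digraph_iso_def by blast
    let ?f = "iso_verts h"
    have pS: "pverts S = ?f ` pverts T" and aS: "parcs S = iso_arcs h ` parcs T"
      \<comment> \<open>As \<open>S\<close> is a pair graph, its tail and head maps are projections,
        so \<open>h\<close> must send an arc to the pair of images of its ends.\<close>
      and ht: "iso_tail h = fst" "iso_head h = snd"
      using arg_cong[OF h(2), of verts] arg_cong[OF h(2), of arcs]
        arg_cong[OF h(2), of tail] arg_cong[OF h(2), of head] by simp_all
    have "(?f u, ?f v) \<in> parcs H" if uv: "(u, v) \<in> parcs T" for u v
    proof -
      have "?f u = fst (iso_arcs h (u, v))" "?f v = snd (iso_arcs h (u, v))"
        using T.iso_verts_tail[OF h(1) uv] T.iso_verts_head[OF h(1) uv] ht by simp_all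
      then have "(?f u, ?f v) = iso_arcs h (u, v)" by simp
      then have "(?f u, ?f v) \<in> parcs S" using aS uv by auto
      then show ?thesis using S(2) by (auto elim!: subgraphE)
    qed
    moreover have "inj_on ?f (pverts T)"
      using T.digraph_isomorphism_inj_on_verts[OF h(1)] .
    moreover have "?f ` pverts T \<subseteq> pverts H"
      using subgraph_imp_subverts[OF S(2)] pS by simp
    ultimately show ?R by blast
  }
  assume ?R
  then obtain f where inj: "inj_on f (pverts T)" and fV: "f ` pverts T \<subseteq> pverts H"
    and arc: "\<And>u v. (u, v) \<in> parcs T \<Longrightarrow> (f u, f v) \<in> parcs H" by blast
  define S where "S = \<lparr> pverts = f ` pverts T, parcs = map_prod f f ` parcs T \<rparr>"
  define h where "h = \<lparr> iso_verts = f, iso_arcs = map_prod f f, iso_head = snd, iso_tail = fst \<rparr>"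
  have "sym (parcs S)"
    unfolding S_def using T.arcs_symmetric by (force intro!: symI)
  then have "symmetric (with_proj S)" by (simp add: symmetric_def)
  then have "pair_graph S"
    using T.pair_finite_verts T.pair_finite_arcs arc H.no_loops'
    by unfold_locales (auto simp: S_def dest: T.wellformed')
  moreover have "subgraph (with_proj S) (with_proj H)"
  proof (rule subgraphI)
    show "wf_digraph (with_proj S)" "wf_digraph (with_proj H)"
      using \<open>pair_graph S\<close> \<open>pair_graph H\<close> 
      by (auto simp: wf_digraph_wp_iff pair_graph_def pair_digraph_def pair_fin_digraph_def)
  qed (use fV arc in \<open>auto simp: S_def compatible_def\<close>)
  moreover have "digraph_iso (with_proj T) (with_proj S)"
    unfolding digraph_iso_def
  proof (intro exI conjI)
    have "inj_on (map_prod f f) (parcs T)"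
    proof (rule inj_on_subset)
      show "inj_on (map_prod f f) (pverts T \<times> pverts T)"
        using inj inj by (rule map_prod_inj_on)
    qed (auto dest: T.wellformed')
    then show "T.digraph_isomorphism h"
      unfolding T.digraph_isomorphism_def using inj T.wf_digraph by (auto simp: h_def)
    show "with_proj S = app_iso h (with_proj T)"
      by (simp add: S_def h_def app_iso_def with_proj_def)
  qed
  ultimately show "embeds_in T H" unfolding embeds_in_def by blast
qed

section \<open>Constructing an embedding into the join\<close>

lemma bipartition_Image_subset:
  assumes "bipartition G A B" "v \<in> A"
  shows "parcs G `` {v} \<subseteq> B"
  using assms unfolding bipartition_def by blast

text \<open>By symmetry, connectedness yields a directed walk from \<open>u\<close> to
  \<open>v\<close>, whose first arc leaves \<open>u\<close>.\<close>

lemma (in pair_graph) vdegree_pos_if_connected: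
  assumes "connected (with_proj G)" "u \<in> pverts G" "v \<in> pverts G" "u \<noteq> v"
  shows "0 < vdegree G u"
proof -
  have "strongly_connected (with_proj G)"
    using symmetric_connected_imp_strongly_connected sym_arcs assms(1) by blast
  then have "u \<rightarrow>\<^sup>*\<^bsub>with_proj G\<^esub> v"
    using assms by (auto elim: strongly_connectedE)
  then obtain p where p: "awalk u p v"
    by (auto simp: reachable_awalk)
  then obtain w where "(u, w) \<in> parcs G"
    using assms(4) by (cases p) (auto simp: awalk_simps)
  moreover have "finite (parcs G `` {u})" by (auto intro: finite_Image pair_finite_arcs)
  ultimately show ?thesis by (auto simp: vdegree_eq_card_Image card_gt_0_iff)
qed

text \<open>Using only \<open>card N\<close> elements of \<open>M\<close> for \<open>N\<close>
  leaves enough of \<open>C\<close> for \<open>B - N\<close>.\<close>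

lemma ex_inj_on_extending_subset:
  assumes "finite B" "finite C" "N \<subseteq> B" "M \<subseteq> C" "card N \<le> card M" "card B \<le> card C"
  obtains g where "inj_on g B" "g ` B \<subseteq> C" "g ` N \<subseteq> M"
proof -
  have fin: "finite N" "finite M" using assms finite_subset by auto
  obtain M' where M': "M' \<subseteq> M" "card M' = card N"
    using assms(5) obtain_subset_with_card_n by metis
  have finM': "finite M'" using M' fin finite_subset by auto
  obtain g1 where g1: "bij_betw g1 N M'"
    using fin finM' M' finite_same_card_bij by metis
  have "card (B - N) \<le> card (C - M')"
    using assms M' fin finM' by (subst (1 2) card_Diff_subset) auto
  then obtain g2 where g2: "inj_on g2 (B - N)" "g2 ` (B - N) \<subseteq> C - M'"
    using assms card_le_inj[of "B - N" "C - M'"] by auto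
  define g where "g x = (if x \<in> N then g1 x else g2 x)" for x
  have gN: "g ` N = M'" using g1 by (auto simp: g_def bij_betw_def)
  have gD: "g ` (B - N) \<subseteq> C - M'" using g2 by (auto simp: g_def)
  have "inj_on g N" "inj_on g (B - N)"
    using g1 g2 by (auto simp: g_def bij_betw_def inj_on_def)
  then have "inj_on g (N \<union> (B - N))"
    using gN gD by (subst inj_on_Un) blast
  then have "inj_on g B" using assms(3) by (simp add: Un_absorb1)
  moreover have "g ` B \<subseteq> C" using gN gD M' assms(4) by blast
  ultimately show thesis using that gN M' by blast
qed

lemma embeds_in_join:
  assumes T: "pair_graph T" "bipartition T A B"
    and v: "v \<in> A" "vdegree T v \<le> vdegree H2 w"
    and H1: "pair_graph H1" "card A \<le> card (pverts H1) + 1"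
    and H2: "pair_graph H2" "w \<in> pverts H2" "card B < card (pverts H2)"
    and disj: "pverts H1 \<inter> pverts H2 = {}"
  shows "embeds_in T (graph_join H1 H2)"
proof -
  interpret T: pair_graph T by fact
  interpret H1: pair_graph H1 by fact
  interpret H2: pair_graph H2 by fact
  have AB: "A \<union> B = pverts T" "A \<inter> B = {}" "parcs T \<subseteq> A \<times> B \<union> B \<times> A"
    using T(2) by (auto simp: bipartition_def)
  then have fin: "finite A" "finite B" using T.pair_finite_verts by (metis finite_Un)+
  have "card (A - {v}) \<le> card (pverts H1)" using v H1 fin by simp
  then obtain h where h: "inj_on h (A - {v})" "h ` (A - {v}) \<subseteq> pverts H1"
    using card_le_inj[of "A - {v}" "pverts H1"] fin H1.pair_finite_verts by auto
  \<comment> \<open>The vertex \<open>w\<close> is reserved for \<open>v\<close>; the strict bound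
    on \<open>card B\<close> pays for it.\<close>
  obtain g where g: "inj_on g B" "g ` B \<subseteq> pverts H2 - {w}"
    "g ` (parcs T `` {v}) \<subseteq> parcs H2 `` {w}"
  proof (rule ex_inj_on_extending_subset)
    show "parcs T `` {v} \<subseteq> B" using bipartition_Image_subset[OF T(2) v(1)] .
    show "parcs H2 `` {w} \<subseteq> pverts H2 - {w}"
      by (auto dest: H2.wellformed' H2.no_loops')
    show "card (parcs T `` {v}) \<le> card (parcs H2 `` {w})"
      using v(2) by (simp add: vdegree_eq_card_Image)
    show "card B \<le> card (pverts H2 - {w})" using H2 by simp
  qed (use fin H2.pair_finite_verts in auto)
  define f where "f x = (if x = v then w else if x \<in> A then h x else g x)" for x
  have fA: "f ` (A - {v}) \<subseteq> pverts H1" using h by (auto simp: f_def)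
  have fB: "f x = g x" if "x \<in> B" for x
    using that AB v by (auto simp: f_def)
  have fv: "f v = w" by (simp add: f_def)
  \<comment> \<open>The domain is split by destination: \<open>A - {v}\<close> goes to
    \<open>H1\<close>, the rest to \<open>H2\<close>.\<close>
  have inj: "inj_on f ((A - {v}) \<union> insert v B)"
  proof (subst inj_on_Un, intro conjI)
    show "inj_on f (A - {v})" using h by (auto simp: f_def inj_on_def)
    have "inj_on f B" using g(1) fB by (simp cong: inj_on_cong)
    moreover have "f ` B \<subseteq> pverts H2 - {w}" using g fB by auto
    ultimately show "inj_on f (insert v B)" using fv by auto
    then show "f ` (A - {v} - insert v B) \<inter> f ` (insert v B - (A - {v})) = {}"
      using fA g(2) fB fv H2(2) disj by fastforce
  qed
  have V: "pverts T = (A - {v}) \<union> insert v B" using AB v by blast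
  have "f ` pverts T \<subseteq> pverts (graph_join H1 H2)"
    unfolding V using fA g(2) fB fv H2(2) by (auto simp: graph_join_def)
  \<comment> \<open>Arcs leaving \<open>v\<close> land in \<open>H2\<close>; all others from
    \<open>A\<close> to \<open>B\<close> cross the join. The reverse orientation follows by
    symmetry.\<close>
  moreover have half: "(f a, f b) \<in> parcs (graph_join H1 H2)"
    if "(a, b) \<in> parcs T" "a \<in> A" "b \<in> B" for a b
  proof (cases "a = v")
    case True
    then have "(w, g b) \<in> parcs H2" using g(3) that by auto
    then show ?thesis using True fv fB that by (simp add: graph_join_def)
  next
    case False
    then have "f a \<in> pverts H1" using fA that by auto
    moreover have "f b \<in> pverts H2" using g(2) fB that by auto
    ultimately show ?thesis by (simp add: graph_join_def)
  qed
  interpret J: pair_graph "graph_join H1 H2"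
    using pair_graph_graph_join H1 H2 disj by blast
  have "(f a, f b) \<in> parcs (graph_join H1 H2)" if "(a, b) \<in> parcs T" for a b
  proof -
    consider "a \<in> A" "b \<in> B" | "b \<in> A" "a \<in> B"
      using \<open>(a, b) \<in> parcs T\<close> AB(3) by blast
    then show ?thesis
      using that half T.arcs_symmetric J.arcs_symmetric by cases blast+
  qed
  ultimately show ?thesis
    using inj V embeds_in_iff[OF T(1) J.pair_graph] by metis
qed

section \<open>The edge count that excludes an embedding\<close>

lemma not_embeds_in_join:
  assumes T: "undirected_tree T" "bipartition T A B"
    and degT: "\<And>a. a \<in> A \<Longrightarrow> \<delta> \<le> vdegree T a"
    and H1: "pair_graph H1" "card (pverts H1) < card A"
    and H2: "pair_graph H2" "\<And>v. v \<in> pverts H2 \<Longrightarrow> vdegree H2 v < \<delta>"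
      "card {v \<in> pverts H2. vdegree H2 v = \<delta> - 1} \<le> 1"
    and disj: "pverts H1 \<inter> pverts H2 = {}"
  shows "\<not> embeds_in T (graph_join H1 H2)"
proof
  assume emb: "embeds_in T (graph_join H1 H2)"
  interpret T: pair_graph T using T(1) by (simp add: undirected_tree_def)
  interpret H1: pair_graph H1 by fact
  interpret H2: pair_graph H2 by fact
  have AB: "A \<union> B = pverts T" "A \<inter> B = {}"
    using T(2) by (auto simp: bipartition_def)
  then have fin: "finite A" "finite B" using T.pair_finite_verts by (metis finite_Un)+
  obtain f where inj: "inj_on f (pverts T)"
    and fV: "f ` pverts T \<subseteq> pverts (graph_join H1 H2)"
    and arc: "\<And>u v. (u, v) \<in> parcs T \<Longrightarrow> (f u, f v) \<in> parcs (graph_join H1 H2)"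
    using emb embeds_in_iff[OF T.pair_graph pair_graph_graph_join[OF H1(1) H2(1) disj]] by blast
  define A' where "A' = {a \<in> A. f a \<notin> pverts H1}"
  define X where "X = {b \<in> B. f b \<in> pverts H1}"
  let ?N = "\<lambda>a. parcs T `` {a}" and ?c = "\<lambda>a. card (parcs T `` {a} \<inter> X)"
  have finX: "finite X" "finite A'" using fin by (auto simp: X_def A'_def)
  \<comment> \<open>\<open>f\<close> maps \<open>A - A'\<close> and \<open>X\<close> into
    \<open>H1\<close>, which has fewer than \<open>card A\<close> vertices.\<close>
  have "card ((A - A') \<union> X) = card (f ` ((A - A') \<union> X))"
    using inj AB by (intro card_image[symmetric] inj_on_subset[OF inj]) (auto simp: X_def)
  also have "\<dots> \<le> card (pverts H1)"
    by (intro card_mono) (auto simp: X_def A'_def H1.pair_finite_verts)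
  also have "card ((A - A') \<union> X) = card (A - A') + card X"
    using AB fin finX by (intro card_Un_disjoint) (auto simp: X_def)
  also have "card (A - A') = card A - card A'"
    by (rule card_Diff_subset) (auto simp: A'_def finX fin)
  finally have XA': "card X < card A'" using H1(2) by linarith
  \<comment> \<open>Neighbours of \<open>a\<close> outside \<open>X\<close> lie in \<open>B\<close>
    and stay outside \<open>H1\<close>, as \<open>a\<close> does, so their edges to \<open>a\<close>
    map to edges of \<open>H2\<close>.\<close>
  have H2_deg: "vdegree T a \<le> ?c a + vdegree H2 (f a)" if a: "a \<in> A'" for a
  proof -
    have "f ` (?N a - X) \<subseteq> parcs H2 `` {f a}"
    proof
      fix y assume "y \<in> f ` (?N a - X)"
      then obtain b where b: "y = f b" "(a, b) \<in> parcs T" "b \<notin> X" by blast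
      moreover have "b \<in> B" using bipartition_Image_subset[OF T(2)] a b by (auto simp: A'_def)
      ultimately have "f b \<notin> pverts H1" "f a \<notin> pverts H1" using a by (auto simp: X_def A'_def)
      then show "y \<in> parcs H2 `` {f a}"
        using arc[OF b(2)] b(1) by (auto simp: graph_join_def dest: H1.wellformed')
    qed
    moreover have "inj_on f (?N a - X)"
      by (rule inj_on_subset[OF inj]) (auto dest: T.wellformed')
    moreover have "finite (parcs H2 `` {f a})" by (auto intro: finite_Image H2.pair_finite_arcs)
    ultimately have "card (?N a - X) \<le> vdegree H2 (f a)"
      unfolding vdegree_eq_card_Image by (metis card_image card_mono)
    moreover have "vdegree T a \<le> card (?N a \<inter> X) + card (?N a - X)"
      unfolding vdegree_eq_card_Image by (metis Int_Diff_Un card_Un_le)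
    ultimately show ?thesis by simp
  qed
  have fA': "f a \<in> pverts H2" if "a \<in> A'" for a
    using that fV AB by (auto simp: A'_def graph_join_def)
  \<comment> \<open>These are the exceptional vertices: outside \<open>Z\<close> the degree in
    \<open>H2\<close> is at most \<delta> - 2, leaving two neighbours in \<open>X\<close>; in
    \<open>Z\<close> only one is guaranteed.\<close>
  define Z where "Z = {a \<in> A'. vdegree H2 (f a) = \<delta> - 1}"
  have "card Z \<le> card {v \<in> pverts H2. vdegree H2 v = \<delta> - 1}"
    by (rule card_inj_on_le[where f = f])
      (use fA' H2.pair_finite_verts AB in \<open>auto simp: Z_def A'_def intro: inj_on_subset[OF inj]\<close>)
  then have Z: "card Z \<le> 1" using H2(3) by simp
  have "2 \<le> ?c a + (if a \<in> Z then 1 else 0)" if a: "a \<in> A'" for a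
    using H2_deg[OF a] degT[of a] H2(2)[OF fA'[OF a]] a
    by (auto simp: Z_def A'_def)
  then have "(\<Sum>a\<in>A'. 2) \<le> (\<Sum>a\<in>A'. ?c a + (if a \<in> Z then 1 else 0))"
    by (rule sum_mono)
  also have "\<dots> = (\<Sum>a\<in>A'. ?c a) + card Z"
    using finX by (simp add: sum.distrib sum.If_cases Z_def Int_def)
  finally have edges: "2 * card A' \<le> (\<Sum>a\<in>A'. ?c a) + 1" using Z by simp
  define E where "E = (SIGMA a:A'. ?N a \<inter> X)"
  have cE: "card E = (\<Sum>a\<in>A'. ?c a)"
    unfolding E_def using finX by (simp add: card_SigmaI)
  with edges have edges': "2 * card A' \<le> card E + 1" by simp
  \<comment> \<open>The arc bound for forests counts both orientations of an edge; they are distinct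
    since \<open>A\<close> and \<open>B\<close> are disjoint.\<close>
  have "card (E \<union> E\<inverse>) = card E + card (E\<inverse>)"
    using finX AB by (intro card_Un_disjoint) (auto simp: E_def A'_def X_def finite_converse)
  then have "2 * card E = card (E \<union> E\<inverse>)" by (simp add: card_inverse)
  also have "\<dots> \<le> card (parcs T \<inter> (A' \<union> X) \<times> (A' \<union> X))"
    by (intro card_mono) (auto simp: E_def T.pair_finite_arcs intro: T.arcs_symmetric)
  finally have "2 * card E + 2 \<le> card (parcs T \<inter> (A' \<union> X) \<times> (A' \<union> X)) + 2"
    by (rule add_right_mono)
  also have "\<dots> \<le> 2 * card (A' \<union> X)"
  proof (rule T.card_arcs_acyclic)
    show "\<not> (\<exists>p. T.cycle p \<and> 3 \<le> length p)" using T(1) by (simp add: undirected_tree_def)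
    show "A' \<union> X \<subseteq> pverts T" using AB by (auto simp: A'_def X_def)
    show "A' \<union> X \<noteq> {}" using XA' by auto
  qed
  also have "\<dots> \<le> 2 * (card A' + card X)" using card_Un_le[of A' X] by simp
  \<comment> \<open>The forest bound gives
    \<open>card E + 1 \<le> card A' + card X < 2 * card A'\<close>, against
    \<open>edges'\<close>.\<close>
  finally show False using edges' XA' by arith
qed

theorem theorem1p2:
  fixes m l \<delta> n :: nat
    and T :: "'a pair_pre_digraph"
    and H1 H2 H :: "'b pair_pre_digraph"
  assumes "T \<in> tree_class m (l + 1) \<delta>"
    and "n \<ge> m"
    and "pair_graph H1" and "card (pverts H1) = l"
    and "pair_graph H2" and "card (pverts H2) = n - l"
    and "pverts H1 \<inter> pverts H2 = {}"
    and "H = graph_join H1 H2"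
  shows "(max_degree H2 \<ge> \<delta> \<longrightarrow> embeds_in T H) \<and>
         (max_degree H2 \<le> \<delta> - 1 \<and> card {v \<in> pverts H2. vdegree H2 v = \<delta> - 1} \<le> 1
            \<longrightarrow> \<not> embeds_in T H)"
proof -
  obtain A B where T: "undirected_tree T" "card (pverts T) = m"
    and bip: "bipartition T A B" and A: "card A \<le> card B" "card A = l + 1"
    and \<delta>: "Min (vdegree T ` A) = \<delta>"
    using assms(1) by (auto simp: tree_class_def)
  interpret T: pair_graph T using T(1) by (simp add: undirected_tree_def)
  interpret H2: pair_graph H2 by fact
  have AB: "A \<union> B = pverts T" "A \<inter> B = {}"
    using bip by (auto simp: bipartition_def)
  then have fin: "finite A" "finite B" using T.pair_finite_verts by (metis finite_Un)+
  then have cB: "card A + card B = m" using AB T(2) card_Un_disjoint by metis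
  have ne: "A \<noteq> {}" "B \<noteq> {}" using A by auto
  have "\<delta> \<in> vdegree T ` A"
    using Min_in[of "vdegree T ` A"] fin ne unfolding \<delta> by simp
  then obtain v where v: "v \<in> A" "vdegree T v = \<delta>" by blast
  have degT: "\<delta> \<le> vdegree T a" if "a \<in> A" for a
    using that fin \<delta> by (metis Min_le finite_imageI imageI)
  \<comment> \<open>A second vertex of the connected tree forces \<delta> > 0, so the truncated
    bound \<delta> - 1 in (ii) means strictly less than \<delta>.\<close>
  obtain b where "b \<in> B" using ne by blast
  then have "0 < \<delta>"
    using T.vdegree_pos_if_connected[of v b] T(1) v AB by (auto simp: undirected_tree_def)
  \<comment> \<open>Since \<open>m = l + 1 + card B\<close>, at least \<open>card B + 1\<close>
    vertices remain in \<open>H2\<close>. In particular the \<open>Max\<close> in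
    \<open>max_degree\<close> is attained.\<close>
  have cB2: "card B < card (pverts H2)" using assms(2,6) cB A by simp
  then have ne2: "pverts H2 \<noteq> {}" by auto
  have max: "vdegree H2 x \<le> max_degree H2" if "x \<in> pverts H2" for x
    using that H2.pair_finite_verts unfolding max_degree_def by (intro Max_ge) auto
  show ?thesis
  proof (intro conjI impI)
    assume \<Delta>: "max_degree H2 \<ge> \<delta>"
    have "max_degree H2 \<in> vdegree H2 ` pverts H2"
      unfolding max_degree_def using H2.pair_finite_verts ne2 by (intro Max_in) auto
    then obtain w where "w \<in> pverts H2" "vdegree H2 w = max_degree H2" by auto
    with \<Delta> show "embeds_in T H"
      using embeds_in_join[OF T.pair_graph bip v(1), of H2 w H1, OF _ assms(3) _ assms(5) _ cB2 assms(7)]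
        v(2) A(2) assms(4,8) by simp
  next
    assume \<Delta>: "max_degree H2 \<le> \<delta> - 1 \<and> card {v \<in> pverts H2. vdegree H2 v = \<delta> - 1} \<le> 1"
    have "vdegree H2 x < \<delta>" if "x \<in> pverts H2" for x
      using max[OF that] \<Delta> \<open>0 < \<delta>\<close> by linarith
    then show "\<not> embeds_in T H"
      using not_embeds_in_join[OF T(1) bip degT assms(3) _ assms(5) _ _ assms(7)]
        \<Delta> A(2) assms(4,8) by simp
  qed
qed

end
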